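(* Let $R$ be a $v$-domain. Then $R$ is Boole $t$-regular and strongly $t$-discrete if and only if $R$ is strongly $t$-stable.
   Context: All rings are integral domains (commutative with identity). Let $R$ be a domain with quotient field $K$. For nonzero fractional ideals (more generally, nonzero $R$-submodules of $K$) $I,J$, put $(I:J)=\{x\in K\mid xJ\subseteq I\}$, $I^{-1}=(R:I)$, $I_v=(I^{-1})^{-1}$, and $I_t=\bigcup J_v$, where $J$ ranges over the nonzero finitely generated subideals of $I$. A nonzero fractional ideal $I$ is a (fractional) $t$-ideal if $I_t=I$. A $t$-prime ideal is a (nonzero) prime ideal of $R$ that is a $t$-ideal. - $R$ is a $v$-domain if $(I_v:I_v)=R$ for each nonzero finitely generated ideal $I$ of $R$. - The $t$-class semigroup $S_t(R)$ is the semigroup of fractional $t$-ideals of $R$, with multiplication $(I,J)\mapsto (IJ)_t$, modulo its subsemigroup of nonzero principal fractional ideals (so $I$ and $J$ have the same class iff $I=cJ$ for some $0\neq c\in K$). $R$ is Boole $t$-regular if $S_t(R)$ is a Boolean semigroup, i.e. $x^2=x$ for all $x\in S_t(R)$; equivalently, for every fractional $t$-ideal $I$ of $R$ there is $0\ne c\in K$ with $(I^2)_t=cI$. - $R$ is strongly $t$-discrete if it has no $t$-idempotent $t$-prime ideals, i.e. $(P^2)_t\subsetneq P$ for every $t$-prime ideal $P$ of $R$. - $R$ is strongly $t$-stable if each $t$-ideal $I$ of $R$ is principal in its endomorphism ring $(I:I)$, i.e. $I=c(I:I)$ for some $c\in I$. *)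

theory Defs
  imports HOL.Hull "HOL-Computational_Algebra.Fraction_Field"
begin

text \<open>
  A domain \<open>R\<close> is represented as a subset of its quotient field \<open>K\<close>, the latter being the
  type \<open>'k\<close>. Integrality of \<open>R\<close> is automatic, as \<open>R\<close> is a subring of a field. All ideals and
  fractional ideals are subsets of \<open>K\<close>.
\<close>

locale domain_with_quotient_field =
  fixes R :: "'k::field set"
  assumes one_mem: "1 \<in> R"
    and diff_mem: "a \<in> R \<Longrightarrow> b \<in> R \<Longrightarrow> a - b \<in> R"
    and mult_mem: "a \<in> R \<Longrightarrow> b \<in> R \<Longrightarrow> a * b \<in> R"
    and fraction: "\<exists>a\<in>R. \<exists>b\<in>R. b \<noteq> 0 \<and> x = a / b"

text \<open>Every integral domain type, embedded in its field of fractions, is an instance.\<close>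

lemma domain_with_quotient_field_fract:
  "domain_with_quotient_field (range (\<lambda>a::'a::idom. Fract a 1))"
proof
  show "1 \<in> range (\<lambda>a::'a. Fract a 1)"
    by (auto simp: One_fract_def)
  show "x - y \<in> range (\<lambda>a::'a. Fract a 1)"
    if "x \<in> range (\<lambda>a::'a. Fract a 1)" "y \<in> range (\<lambda>a::'a. Fract a 1)" for x y
    using that by auto
  show "x * y \<in> range (\<lambda>a::'a. Fract a 1)"
    if "x \<in> range (\<lambda>a::'a. Fract a 1)" "y \<in> range (\<lambda>a::'a. Fract a 1)" for x y
    using that by auto
  show "\<exists>u\<in>range (\<lambda>a::'a. Fract a 1). \<exists>v\<in>range (\<lambda>a::'a. Fract a 1). v \<noteq> 0 \<and> x = u / v"
    for x :: "'a fract"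
  proof (cases x)
    case (Fract a b)
    then have "Fract b 1 \<noteq> 0" "x = Fract a 1 / Fract b 1"
      by (auto simp: Zero_fract_def eq_fract)
    then show ?thesis by blast
  qed
qed


subsection \<open>Submodules of the quotient field\<close>

definition is_submodule :: "'k::field set \<Rightarrow> 'k set \<Rightarrow> bool" where
  "is_submodule R M \<longleftrightarrow>
     0 \<in> M \<and> (\<forall>x\<in>M. \<forall>y\<in>M. x + y \<in> M) \<and> (\<forall>r\<in>R. \<forall>x\<in>M. r * x \<in> M)"

definition fin_gen :: "'k::field set \<Rightarrow> 'k set \<Rightarrow> bool" where
  "fin_gen R M \<longleftrightarrow> (\<exists>F. finite F \<and> M = is_submodule R hull F)"

definition module_prod :: "'k::field set \<Rightarrow> 'k set \<Rightarrow> 'k set \<Rightarrow> 'k set" where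
  "module_prod R I J = is_submodule R hull {x * y |x y. x \<in> I \<and> y \<in> J}"

definition scaled :: "'k::field \<Rightarrow> 'k set \<Rightarrow> 'k set" where
  "scaled c I = (\<lambda>x. c * x) ` I"

definition colon :: "'k::field set \<Rightarrow> 'k set \<Rightarrow> 'k set" where
  "colon I J = {x. \<forall>y\<in>J. x * y \<in> I}"

definition inv_ideal :: "'k::field set \<Rightarrow> 'k set \<Rightarrow> 'k set" where
  "inv_ideal R I = colon R I"

definition v_closure :: "'k::field set \<Rightarrow> 'k set \<Rightarrow> 'k set" where
  "v_closure R I = inv_ideal R (inv_ideal R I)"

definition t_closure :: "'k::field set \<Rightarrow> 'k set \<Rightarrow> 'k set" where
  "t_closure R I = \<Union>{v_closure R J |J. fin_gen R J \<and> J \<noteq> {0} \<and> J \<subseteq> I}"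


subsection \<open>Ideals and fractional ideals\<close>

definition is_ideal :: "'k::field set \<Rightarrow> 'k set \<Rightarrow> bool" where
  "is_ideal R I \<longleftrightarrow> is_submodule R I \<and> I \<subseteq> R"

definition prime_ideal :: "'k::field set \<Rightarrow> 'k set \<Rightarrow> bool" where
  "prime_ideal R P \<longleftrightarrow>
     is_ideal R P \<and> P \<noteq> R \<and> (\<forall>a\<in>R. \<forall>b\<in>R. a * b \<in> P \<longrightarrow> a \<in> P \<or> b \<in> P)"

definition fractional_ideal :: "'k::field set \<Rightarrow> 'k set \<Rightarrow> bool" where
  "fractional_ideal R I \<longleftrightarrow> is_submodule R I \<and> (\<exists>d\<in>R. d \<noteq> 0 \<and> scaled d I \<subseteq> R)"

text \<open>A \<open>t\<close>-ideal is nonzero and may be fractional, i.e. need not be contained in \<open>R\<close>.\<close>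

definition t_ideal :: "'k::field set \<Rightarrow> 'k set \<Rightarrow> bool" where
  "t_ideal R I \<longleftrightarrow> fractional_ideal R I \<and> I \<noteq> {0} \<and> t_closure R I = I"

definition t_prime_ideal :: "'k::field set \<Rightarrow> 'k set \<Rightarrow> bool" where
  "t_prime_ideal R P \<longleftrightarrow> prime_ideal R P \<and> t_ideal R P"


subsection \<open>The \<open>t\<close>-class semigroup\<close>

definition t_mult :: "'k::field set \<Rightarrow> 'k set \<Rightarrow> 'k set \<Rightarrow> 'k set" where
  "t_mult R I J = t_closure R (module_prod R I J)"

definition t_class_rel :: "'k::field set \<Rightarrow> ('k set \<times> 'k set) set" where
  "t_class_rel R =
     {(I, J). t_ideal R I \<and> t_ideal R J \<and> (\<exists>c. c \<noteq> 0 \<and> I = scaled c J)}"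

definition t_class_semigroup :: "'k::field set \<Rightarrow> 'k set set set" where
  "t_class_semigroup R = {I. t_ideal R I} // t_class_rel R"

text \<open>The union is over a family with a single member, by \<open>t_class_mult_class\<close> below.\<close>

definition t_class_mult :: "'k::field set \<Rightarrow> 'k set set \<Rightarrow> 'k set set \<Rightarrow> 'k set set" where
  "t_class_mult R X Y = (\<Union>I\<in>X. \<Union>J\<in>Y. t_class_rel R `` {t_mult R I J})"


subsection \<open>Classes of domains\<close>

definition v_domain :: "'k::field set \<Rightarrow> bool" where
  "v_domain R \<longleftrightarrow>
     (\<forall>I. is_ideal R I \<and> fin_gen R I \<and> I \<noteq> {0} \<longrightarrow>
        colon (v_closure R I) (v_closure R I) = R)"

definition Boole_t_regular :: "'k::field set \<Rightarrow> bool" where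
  "Boole_t_regular R \<longleftrightarrow> (\<forall>X\<in>t_class_semigroup R. t_class_mult R X X = X)"

definition strongly_t_discrete :: "'k::field set \<Rightarrow> bool" where
  "strongly_t_discrete R \<longleftrightarrow> (\<forall>P. t_prime_ideal R P \<longrightarrow> t_mult R P P \<subset> P)"

definition strongly_t_stable :: "'k::field set \<Rightarrow> bool" where
  "strongly_t_stable R \<longleftrightarrow>
     (\<forall>I. t_ideal R I \<longrightarrow> (\<exists>c\<in>I. I = scaled c (colon I I)))"


subsection \<open>Well-definedness of the multiplication of classes\<close>

lemma scaled_scaled: "scaled a (scaled b I) = scaled (a * b) I"
  by (auto simp: scaled_def image_image mult.assoc)

lemma scaled_one [simp]: "scaled 1 I = I"
  by (simp add: scaled_def)

lemma mem_scaled_iff: "c \<noteq> 0 \<Longrightarrow> x \<in> scaled c I \<longleftrightarrow> x / c \<in> I"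
  by (force simp: scaled_def)

lemma scaled_mono: "I \<subseteq> J \<Longrightarrow> scaled c I \<subseteq> scaled c J"
  by (auto simp: scaled_def)

lemma scaled_subset_iff: "c \<noteq> 0 \<Longrightarrow> scaled c I \<subseteq> J \<longleftrightarrow> I \<subseteq> scaled (1 / c) J"
  by (auto simp: mem_scaled_iff subset_iff mult.commute)

lemma scaled_eq_zero_iff: "c \<noteq> 0 \<Longrightarrow> scaled c I = {0} \<longleftrightarrow> I = {0}"
  using inj_image_eq_iff[of "(*) c" I "{0}"] by (simp add: scaled_def inj_on_def)

lemma is_submodule_scaled: "is_submodule R M \<Longrightarrow> is_submodule R (scaled c M)"
  by (auto simp: is_submodule_def scaled_def mult.left_commute[of _ c] simp flip: distrib_left)

lemma is_submodule_hull: "is_submodule R (is_submodule R hull S)"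
  by (rule hull_in) (auto simp: is_submodule_def)

lemma hull_scaled_subset: "is_submodule R hull scaled c S \<subseteq> scaled c (is_submodule R hull S)"
  by (intro hull_minimal scaled_mono hull_subset is_submodule_scaled is_submodule_hull)

lemma hull_scaled:
  assumes "c \<noteq> 0"
  shows "is_submodule R hull scaled c S = scaled c (is_submodule R hull S)"
proof
  have "is_submodule R hull scaled (1 / c) (scaled c S)
      \<subseteq> scaled (1 / c) (is_submodule R hull scaled c S)"
    by (rule hull_scaled_subset)
  then show "scaled c (is_submodule R hull S) \<subseteq> is_submodule R hull scaled c S"
    using assms by (simp add: scaled_scaled scaled_subset_iff)
qed (rule hull_scaled_subset)

lemma fin_gen_scaled: "c \<noteq> 0 \<Longrightarrow> fin_gen R J \<Longrightarrow> fin_gen R (scaled c J)"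
  unfolding fin_gen_def by (metis finite_imageI hull_scaled scaled_def)

lemma inv_ideal_scaled: "c \<noteq> 0 \<Longrightarrow> inv_ideal R (scaled c I) = scaled (1 / c) (inv_ideal R I)"
  by (auto simp: inv_ideal_def colon_def mem_scaled_iff) (auto simp: scaled_def mult_ac)

lemma v_closure_scaled: "c \<noteq> 0 \<Longrightarrow> v_closure R (scaled c I) = scaled c (v_closure R I)"
  by (simp add: v_closure_def inv_ideal_scaled)

lemma t_closure_scaled_subset:
  assumes "c \<noteq> 0"
  shows "scaled c (t_closure R I) \<subseteq> t_closure R (scaled c I)"
proof
  fix x assume "x \<in> scaled c (t_closure R I)"
  then obtain J where J: "fin_gen R J" "J \<noteq> {0}" "J \<subseteq> I" "x / c \<in> v_closure R J"
    using assms by (auto simp: mem_scaled_iff t_closure_def)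
  then have "x \<in> v_closure R (scaled c J)"
    using assms by (simp add: v_closure_scaled mem_scaled_iff)
  moreover have "fin_gen R (scaled c J)" "scaled c J \<noteq> {0}" "scaled c J \<subseteq> scaled c I"
    using J assms by (simp_all add: fin_gen_scaled scaled_eq_zero_iff scaled_mono)
  ultimately show "x \<in> t_closure R (scaled c I)"
    unfolding t_closure_def by blast
qed

lemma t_closure_scaled:
  assumes "c \<noteq> 0"
  shows "t_closure R (scaled c I) = scaled c (t_closure R I)"
proof
  have "scaled (1 / c) (t_closure R (scaled c I)) \<subseteq> t_closure R (scaled (1 / c) (scaled c I))"
    using assms by (intro t_closure_scaled_subset) simp
  then show "t_closure R (scaled c I) \<subseteq> scaled c (t_closure R I)"
    using assms by (simp add: scaled_scaled scaled_subset_iff)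
qed (use assms in \<open>rule t_closure_scaled_subset\<close>)

lemma module_prod_scaled:
  assumes "a \<noteq> 0" "b \<noteq> 0"
  shows "module_prod R (scaled a I) (scaled b J) = scaled (a * b) (module_prod R I J)"
proof -
  have "{x * y |x y. x \<in> scaled a I \<and> y \<in> scaled b J} = scaled (a * b) {x * y |x y. x \<in> I \<and> y \<in> J}"
    by (auto simp: scaled_def image_iff) (metis mult.assoc mult.left_commute)+
  then show ?thesis
    using assms by (simp add: module_prod_def hull_scaled)
qed

lemma t_mult_scaled:
  "a \<noteq> 0 \<Longrightarrow> b \<noteq> 0 \<Longrightarrow> t_mult R (scaled a I) (scaled b J) = scaled (a * b) (t_mult R I J)"
  by (simp add: t_mult_def module_prod_scaled t_closure_scaled)

context domain_with_quotient_field
begin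

lemma t_ideal_scaled:
  assumes "c \<noteq> 0" "t_ideal R I"
  shows "t_ideal R (scaled c I)"
proof -
  obtain d where d: "d \<in> R" "d \<noteq> 0" "scaled d I \<subseteq> R"
    using assms by (auto simp: t_ideal_def fractional_ideal_def)
  obtain a b where ab: "a \<in> R" "b \<in> R" "b \<noteq> 0" "c = a / b"
    using fraction by blast
  have "d * b * (c * x) \<in> R" if "x \<in> I" for x
  proof -
    have "d * b * (c * x) = a * (d * x)" using ab by simp
    moreover have "d * x \<in> R" using that d by (auto simp: scaled_def)
    ultimately show ?thesis using ab by (simp only: mult_mem)
  qed
  then have "\<exists>e\<in>R. e \<noteq> 0 \<and> scaled e (scaled c I) \<subseteq> R"
    using ab d by (intro bexI[of _ "d * b"]) (auto simp: scaled_def mult_mem)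
  then show ?thesis
    using assms
    by (simp add: t_ideal_def fractional_ideal_def is_submodule_scaled t_closure_scaled
        scaled_eq_zero_iff)
qed

lemma equiv_t_class_rel: "equiv {I. t_ideal R I} (t_class_rel R)"
proof (rule equivI)
  show "t_class_rel R \<subseteq> {I. t_ideal R I} \<times> {I. t_ideal R I}"
    by (auto simp: t_class_rel_def)
  show "refl_on {I. t_ideal R I} (t_class_rel R)"
    by (auto simp: refl_on_def t_class_rel_def intro: exI[of _ 1])
  show "sym (t_class_rel R)"
  proof (rule symI)
    fix I J assume "(I, J) \<in> t_class_rel R"
    then obtain c where c: "c \<noteq> 0" "I = scaled c J" and t: "t_ideal R I" "t_ideal R J"
      by (auto simp: t_class_rel_def)
    then have "J = scaled (1 / c) I" by (simp add: scaled_scaled)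
    with c t show "(J, I) \<in> t_class_rel R"
      unfolding t_class_rel_def by (auto intro!: exI[of _ "1 / c"])
  qed
  show "trans (t_class_rel R)"
    unfolding trans_def t_class_rel_def by (auto simp: scaled_scaled) (metis no_zero_divisors)
qed

lemma t_class_rel_scaled:
  assumes "c \<noteq> 0"
  shows "t_class_rel R `` {scaled c I} = t_class_rel R `` {I}"
proof (cases "t_ideal R I")
  case True
  with assms have "(scaled c I, I) \<in> t_class_rel R"
    by (auto simp: t_class_rel_def t_ideal_scaled)
  then show ?thesis by (rule equiv_class_eq[OF equiv_t_class_rel])
next
  case False
  moreover have "\<not> t_ideal R (scaled c I)"
  proof
    assume "t_ideal R (scaled c I)"
    then have "t_ideal R (scaled (1 / c) (scaled c I))"
      using assms by (intro t_ideal_scaled[of "1 / c"]) simp_all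
    with False assms show False by (simp add: scaled_scaled)
  qed
  ultimately show ?thesis by (auto simp: t_class_rel_def)
qed

lemma t_class_mult_class:
  assumes "t_ideal R I" "t_ideal R J"
  shows "t_class_mult R (t_class_rel R `` {I}) (t_class_rel R `` {J})
    = t_class_rel R `` {t_mult R I J}"
proof -
  have "t_class_rel R `` {t_mult R I' J'} = t_class_rel R `` {t_mult R I J}"
    if "I' \<in> t_class_rel R `` {I}" "J' \<in> t_class_rel R `` {J}" for I' J'
  proof -
    obtain a b where "a \<noteq> 0" "I = scaled a I'" "b \<noteq> 0" "J = scaled b J'"
      using \<open>I' \<in> _\<close> \<open>J' \<in> _\<close> by (auto simp: t_class_rel_def)
    then show ?thesis by (simp add: t_mult_scaled t_class_rel_scaled)
  qed
  moreover have "I \<in> t_class_rel R `` {I}" "J \<in> t_class_rel R `` {J}"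
    using assms equiv_class_self[OF equiv_t_class_rel] by blast+
  ultimately show ?thesis unfolding t_class_mult_def by blast
qed

lemma Boole_t_regular_iff:
  "Boole_t_regular R \<longleftrightarrow> (\<forall>I. t_ideal R I \<longrightarrow> (\<exists>c. c \<noteq> 0 \<and> t_mult R I I = scaled c I))"
proof -
  have "t_class_rel R `` {t_mult R I I} = t_class_rel R `` {I}
      \<longleftrightarrow> (\<exists>c. c \<noteq> 0 \<and> t_mult R I I = scaled c I)" if I: "t_ideal R I" for I
  proof
    assume "t_class_rel R `` {t_mult R I I} = t_class_rel R `` {I}"
    then have "(t_mult R I I, I) \<in> t_class_rel R"
      using equiv_class_self[OF equiv_t_class_rel, of I] I by blast
    then show "\<exists>c. c \<noteq> 0 \<and> t_mult R I I = scaled c I" by (auto simp: t_class_rel_def)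
  qed (metis t_class_rel_scaled)
  then show ?thesis
    unfolding Boole_t_regular_def t_class_semigroup_def
    by (auto simp: quotient_def t_class_mult_class)
qed

end

end

theory Submission
  imports Defs
begin

text \<open>
  If every \<open>t\<close>-ideal \<open>I\<close> has the form \<open>c(I:I)\<close>, then \<open>I\<^sup>2 = c\<^sup>2(I:I) = cI\<close>, so \<open>R\<close> is Boole
  \<open>t\<close>-regular; and a \<open>t\<close>-idempotent prime \<open>P\<close> would satisfy \<open>P = cP\<close>, hence \<open>P = (P:P)\<close>,
  hence \<open>1 \<in> P\<close>.

  For the converse, let \<open>R\<close> be a Boole \<open>t\<close>-regular \<open>v\<close>-domain. The first point is that \<open>R\<close> is a
  GCD domain (\<open>gcd_exists_if_Boole\<close>). Let \<open>V = {a, b}\<^sub>v\<close> and \<open>(V\<^sup>2)\<^sub>t = cV\<close>. Then \<open>a\<close> and \<open>b\<close>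
  multiply \<open>V\<close> into \<open>cV\<close>, and \<open>yc\<close> multiplies \<open>V\<close> into \<open>V\<close> whenever \<open>yV \<subseteq> R\<close>. As
  \<open>(V:V) = R\<close>, both \<open>a\<close> and \<open>b\<close> lie in \<open>cR\<close>, and \<open>c\<close> lies in \<open>{a, b}\<^sub>v\<close>; so \<open>V = cR\<close>.

  Over a GCD domain, \<open>t\<close>-ideals are the nonzero fractional ideals closed under gcds, and
  \<open>(I\<^sup>2)\<^sub>t\<close> consists of the multiples of the squares of elements of \<open>I\<close>. Given a \<open>t\<close>-ideal \<open>I\<close>
  with \<open>(I\<^sup>2)\<^sub>t = cI\<close>, the \<open>t\<close>-ideal \<open>J = c\<^sup>-\<^sup>1I\<close> is \<open>t\<close>-idempotent, so each of its elements
  is a multiple of the square of an element of \<open>J\<close>. If \<open>1 \<in> J\<close>, then \<open>J = (J:J) = (I:I)\<close> and we are done.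
  Otherwise \<open>J \<inter> R\<close> is a proper ideal that is still gcd-closed and idempotent, and by Zorn's
  lemma it lies in a maximal such ideal \<open>P\<close>. The properties of being gcd-closed and idempotent pass
  from \<open>P\<close> to \<open>(P : b)\<close> for every nonzero \<open>b \<in> R\<close>, so by maximality \<open>(P : b)\<close> is \<open>P\<close> or \<open>R\<close>; this
  says that \<open>P\<close> is prime. Thus \<open>P\<close> is a \<open>t\<close>-idempotent \<open>t\<close>-prime, which strong
  \<open>t\<close>-discreteness forbids.
\<close>


section \<open>Closure operations on submodules\<close>

lemma colon_scaled: "c \<noteq> 0 \<Longrightarrow> colon (scaled c I) (scaled c I) = colon I I"
  by (auto simp: colon_def scaled_def image_iff mult.left_commute)

lemma mem_v_closure_iff:
  "x \<in> v_closure R A \<longleftrightarrow> (\<forall>y. (\<forall>a\<in>A. y * a \<in> R) \<longrightarrow> x * y \<in> R)"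
  by (auto simp: v_closure_def inv_ideal_def colon_def)

lemma subset_v_closure: "A \<subseteq> v_closure R A"
  unfolding subset_iff mem_v_closure_iff by (metis mult.commute)

lemma v_closure_least: "A \<subseteq> v_closure R B \<Longrightarrow> v_closure R A \<subseteq> v_closure R B"
  unfolding subset_iff mem_v_closure_iff by (metis mult.commute)

lemma t_closure_mono: "I \<subseteq> J \<Longrightarrow> t_closure R I \<subseteq> t_closure R J"
  unfolding t_closure_def by blast

lemma mult_mem_module_prod: "x \<in> I \<Longrightarrow> y \<in> J \<Longrightarrow> x * y \<in> module_prod R I J"
  unfolding module_prod_def by (rule hull_inc) blast

lemma module_prod_least:
  assumes "is_submodule R M" "\<And>x y. x \<in> I \<Longrightarrow> y \<in> J \<Longrightarrow> x * y \<in> M"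
  shows "module_prod R I J \<subseteq> M"
  unfolding module_prod_def using assms by (intro hull_minimal) auto

lemma hull_subset_iff:
  "is_submodule R M \<Longrightarrow> is_submodule R hull S \<subseteq> M \<longleftrightarrow> S \<subseteq> M"
  by (meson hull_minimal hull_subset order_trans)

lemma fin_gen_hull: "finite F \<Longrightarrow> fin_gen R (is_submodule R hull F)"
  unfolding fin_gen_def by (intro exI[of _ F] conjI refl)

lemma submodule_nonzero_element:
  assumes "is_submodule R M" "M \<noteq> {0}"
  obtains z where "z \<in> M" "z \<noteq> 0"
proof -
  have "0 \<in> M" using assms(1) by (simp add: is_submodule_def)
  with assms(2) that show thesis by blast
qed

lemma subset_t_closure:
  assumes "is_submodule R M" "M \<noteq> {0}"
  shows "M \<subseteq> t_closure R M"
proof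
  fix x assume x: "x \<in> M"
  obtain z where z: "z \<in> M" "z \<noteq> 0"
    using assms by (rule submodule_nonzero_element)
  \<comment> \<open>The second generator keeps the finitely generated submodule nonzero when \<open>x = 0\<close>.\<close>
  define A where "A = is_submodule R hull {x, z}"
  have "x \<in> A" "z \<in> A" unfolding A_def by (auto intro: hull_inc)
  moreover have "A \<subseteq> M" unfolding A_def using x z assms by (simp add: hull_subset_iff)
  moreover have "fin_gen R A" unfolding A_def by (simp add: fin_gen_hull)
  ultimately show "x \<in> t_closure R M"
    unfolding t_closure_def using z subset_v_closure[of A R] by auto
qed

context domain_with_quotient_field
begin

lemma zero_mem: "0 \<in> R"
  using diff_mem[OF one_mem one_mem] by simp

lemma add_mem: "a \<in> R \<Longrightarrow> b \<in> R \<Longrightarrow> a + b \<in> R"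
  using diff_mem[of a "0 - b"] diff_mem[of 0 b] zero_mem by simp

lemma is_submodule_self: "is_submodule R R"
  by (auto simp: is_submodule_def zero_mem add_mem mult_mem)

lemma is_submodule_v_closure: "is_submodule R (v_closure R A)"
  by (auto simp: is_submodule_def mem_v_closure_iff zero_mem add_mem mult_mem distrib_right mult.assoc)

lemma common_denominator: "\<exists>d\<in>R. d \<noteq> 0 \<and> d * a \<in> R \<and> d * b \<in> R"
proof -
  obtain u v u' v' where "u \<in> R" "v \<in> R" "v \<noteq> 0" "a = u / v"
    and "u' \<in> R" "v' \<in> R" "v' \<noteq> 0" "b = u' / v'"
    using fraction by metis
  then show ?thesis
    by (intro bexI[of _ "v * v'"]) (auto simp: mult_mem mult.commute)
qed


section \<open>Strong stability implies regularity and discreteness\<close>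

text \<open>
  Already \<open>I\<^sup>2 = cI\<close>: one factor is in \<open>c(I:I)\<close>, and conversely \<open>c\<close> itself is an element of \<open>I\<close>.
\<close>

lemma t_mult_if_stable:
  assumes "t_ideal R I" "I = scaled c (colon I I)" "c \<noteq> 0" "c \<in> I"
  shows "t_mult R I I = scaled c I"
proof -
  have sub: "is_submodule R (scaled c I)"
    using assms(1) by (auto simp: t_ideal_def fractional_ideal_def is_submodule_scaled)
  have "module_prod R I I = scaled c I"
  proof
    show "module_prod R I I \<subseteq> scaled c I"
    proof (rule module_prod_least[OF sub])
      fix x y assume "x \<in> I" "y \<in> I"
      then have "x / c \<in> colon I I" using assms(2,3) mem_scaled_iff by blast
      then have "x / c * y \<in> I" using \<open>y \<in> I\<close> by (auto simp: colon_def)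
      then show "x * y \<in> scaled c I" using assms(3) by (simp add: mem_scaled_iff)
    qed
    show "scaled c I \<subseteq> module_prod R I I"
      using assms(4) by (auto simp: scaled_def mult_mem_module_prod)
  qed
  then show ?thesis
    using assms(1,3) by (simp add: t_mult_def t_closure_scaled t_ideal_def)
qed

lemma stable_generator:
  assumes "strongly_t_stable R" "t_ideal R I"
  obtains c where "c \<noteq> 0" "c \<in> I" "I = scaled c (colon I I)" "t_mult R I I = scaled c I"
proof -
  obtain c where c: "c \<in> I" "I = scaled c (colon I I)"
    using assms by (auto simp: strongly_t_stable_def)
  have nz: "c \<noteq> 0"
  proof
    assume "c = 0"
    then have "I \<subseteq> {0}" using c(2) by (auto simp: scaled_def)
    then show False using c(1) assms(2) by (auto simp: t_ideal_def)
  qed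
  show thesis
    by (rule that[OF nz c t_mult_if_stable[OF assms(2) c(2) nz c(1)]])
qed

lemma Boole_if_stable: "strongly_t_stable R \<Longrightarrow> Boole_t_regular R"
  unfolding Boole_t_regular_iff using stable_generator by metis

lemma discrete_if_stable:
  assumes "strongly_t_stable R"
  shows "strongly_t_discrete R"
  unfolding strongly_t_discrete_def
proof (intro allI impI)
  fix P assume P: "t_prime_ideal R P"
  then have t: "t_ideal R P" by (simp add: t_prime_ideal_def)
  have PR: "P \<subseteq> R" "is_submodule R P" "P \<noteq> R"
    using P by (auto simp: t_prime_ideal_def prime_ideal_def is_ideal_def)
  obtain c where c: "c \<noteq> 0" "c \<in> P" "P = scaled c (colon P P)" "t_mult R P P = scaled c P"
    using stable_generator[OF assms t] .
  have "scaled c P \<subseteq> P"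
    using c(2) PR by (auto simp: scaled_def is_submodule_def)
  moreover have "scaled c P \<noteq> P"
  proof
    assume eq: "scaled c P = P"
    then have "c / c \<in> P" using c(1,2) mem_scaled_iff[of c c P] by simp
    then have "1 \<in> P" using c(1) by simp
    then have "R \<subseteq> P" using PR by (auto simp: is_submodule_def) (metis mult.right_neutral)
    then show False using PR by blast
  qed
  ultimately show "t_mult R P P \<subset> P" using c(4) by blast
qed


section \<open>Greatest common divisors from Boole regularity\<close>

text \<open>
  This says \<open>{a, b}\<^sub>v = gR\<close>, for arbitrary elements of the quotient field. The case \<open>g = 1\<close>
  serves as the notion of coprimality: a fraction whose products with \<open>a\<close> and \<open>b\<close> are both in
  \<open>R\<close> is itself in \<open>R\<close>.
\<close>

definition is_gcd :: "'k \<Rightarrow> 'k \<Rightarrow> 'k \<Rightarrow> bool" where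
  "is_gcd g a b \<longleftrightarrow> g \<noteq> 0 \<and> a / g \<in> R \<and> b / g \<in> R \<and>
     (\<forall>y. y * a \<in> R \<longrightarrow> y * b \<in> R \<longrightarrow> y * g \<in> R)"

lemma t_ideal_v_closure_pair:
  assumes "a \<noteq> 0"
  shows "t_ideal R (v_closure R (is_submodule R hull {a, b}))" (is "t_ideal R ?V")
proof -
  let ?A = "is_submodule R hull {a, b}"
  have mem: "a \<in> ?A" "b \<in> ?A" by (auto intro: hull_inc)
  have nz: "?V \<noteq> {0}" "?A \<noteq> {0}" using mem assms subset_v_closure[of ?A R] by auto
  obtain d where d: "d \<in> R" "d \<noteq> 0" "d * a \<in> R" "d * b \<in> R"
    using common_denominator by blast
  have "?A \<subseteq> scaled (1 / d) R"
    using d by (simp add: hull_subset_iff is_submodule_scaled is_submodule_self mem_scaled_iff mult.commute)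
  then have "\<forall>x\<in>?A. d * x \<in> R" using d by (auto simp: mem_scaled_iff mult.commute)
  then have "scaled d ?V \<subseteq> R"
    by (auto simp: scaled_def mem_v_closure_iff mult.commute[of d])
  then have frac: "fractional_ideal R ?V"
    using d is_submodule_v_closure by (auto simp: fractional_ideal_def)
  have "t_closure R ?V \<subseteq> ?V"
    unfolding t_closure_def using v_closure_least by blast
  moreover have "?V \<subseteq> t_closure R ?V"
    using nz is_submodule_v_closure by (intro subset_t_closure)
  ultimately show ?thesis using frac nz by (auto simp: t_ideal_def)
qed

text \<open>Clearing denominators reduces this to the integral ideals in the definition of \<open>v\<close>-domains.\<close>

lemma colon_v_closure_pair:
  assumes "v_domain R" "a \<noteq> 0"
  shows "colon (v_closure R (is_submodule R hull {a, b})) (v_closure R (is_submodule R hull {a, b})) = R"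
proof -
  let ?A = "is_submodule R hull {a, b}"
  obtain d where d: "d \<in> R" "d \<noteq> 0" "d * a \<in> R" "d * b \<in> R"
    using common_denominator by blast
  have eq: "scaled d ?A = is_submodule R hull {d * a, d * b}"
    using hull_scaled[OF d(2), of R "{a, b}"] by (simp add: scaled_def)
  have "is_ideal R (scaled d ?A)"
    unfolding eq is_ideal_def using d by (simp add: is_submodule_hull hull_subset_iff is_submodule_self)
  moreover have "fin_gen R (scaled d ?A)" unfolding eq by (simp add: fin_gen_hull)
  moreover have "a \<in> ?A" by (auto intro: hull_inc)
  then have "scaled d ?A \<noteq> {0}" using assms(2) d(2) by (auto simp: scaled_eq_zero_iff)
  ultimately have "colon (v_closure R (scaled d ?A)) (v_closure R (scaled d ?A)) = R"
    using assms(1) by (auto simp: v_domain_def)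
  then show ?thesis using d(2) by (simp add: v_closure_scaled colon_scaled)
qed

text \<open>
  The factor \<open>c\<close> by which squaring acts on \<open>V = {a, b}\<^sub>v\<close> is the gcd: membership in \<open>R\<close> is
  tested by multiplying \<open>V\<close> into itself, and \<open>cV = (V\<^sup>2)\<^sub>t\<close> absorbs the products with \<open>a\<close>
  and \<open>b\<close>.
\<close>

lemma gcd_exists_if_Boole:
  assumes "v_domain R" "Boole_t_regular R" "a \<noteq> 0"
  shows "\<exists>g. is_gcd g a b"
proof -
  define A where "A = is_submodule R hull {a, b}"
  define V where "V = v_closure R A"
  have "t_ideal R V"
    unfolding V_def A_def using assms by (intro t_ideal_v_closure_pair)
  have VV: "colon V V = R"
    unfolding V_def A_def using assms by (intro colon_v_closure_pair)
  have sV: "is_submodule R V" "V \<noteq> {0}" and tV: "t_closure R V = V"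
    using \<open>t_ideal R V\<close> by (auto simp: t_ideal_def fractional_ideal_def)
  obtain c where c: "c \<noteq> 0" "t_mult R V V = scaled c V"
    using assms(2) \<open>t_ideal R V\<close> by (auto simp: Boole_t_regular_iff)
  have ab: "a \<in> V" "b \<in> V"
    using subset_v_closure[of A R] unfolding V_def A_def by (auto intro: hull_inc)
  have "a * a \<in> module_prod R V V" using ab by (intro mult_mem_module_prod)
  then have "module_prod R V V \<noteq> {0}" using assms(3) by (metis mult_eq_0_iff singletonD)
  then have prod: "module_prod R V V \<subseteq> scaled c V"
    using subset_t_closure[of R "module_prod R V V"] c(2)
    by (simp add: t_mult_def module_prod_def is_submodule_hull)
  have div: "x / c \<in> R" if "x \<in> V" for x
  proof -
    have "x * v / c \<in> V" if "v \<in> V" for v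
      using prod mult_mem_module_prod[OF \<open>x \<in> V\<close> that, of R] c(1) by (auto simp: mem_scaled_iff)
    then have "x / c \<in> colon V V" by (simp add: colon_def)
    then show ?thesis by (simp add: VV)
  qed
  have gen: "y * c \<in> R" if y: "y * a \<in> R" "y * b \<in> R" for y
  proof (cases "y = 0")
    case False
    have "A \<subseteq> scaled (1 / y) R" unfolding A_def
      using y False
      by (simp add: hull_subset_iff is_submodule_scaled is_submodule_self mem_scaled_iff mult.commute)
    then have "\<forall>x\<in>A. y * x \<in> R" using False by (auto simp: mem_scaled_iff mult.commute)
    then have yV: "y * x \<in> R" if "x \<in> V" for x
      using that unfolding V_def mem_v_closure_iff by (metis mult.commute)
    have "module_prod R V V \<subseteq> scaled (1 / y) V"
    proof (rule module_prod_least)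
      fix u v assume "u \<in> V" "v \<in> V"
      then have "y * u * v \<in> V" using sV yV by (auto simp: is_submodule_def)
      then show "u * v \<in> scaled (1 / y) V"
        using False by (simp add: mem_scaled_iff mult.commute mult.left_commute)
    qed (simp add: sV is_submodule_scaled)
    then have "scaled c V \<subseteq> scaled (1 / y) V"
      using t_closure_mono[of "module_prod R V V" "scaled (1 / y) V" R] False tV c(2)
      by (simp add: t_mult_def t_closure_scaled)
    then have "y * c * v \<in> V" if "v \<in> V" for v
      using that False
      by (auto simp: scaled_def[of c] mem_scaled_iff image_subset_iff mult_ac)
    then have "y * c \<in> colon V V" by (simp add: colon_def)
    then show ?thesis by (simp add: VV)
  qed (simp add: zero_mem)
  show ?thesis
    unfolding is_gcd_def using c(1) ab div gen by blast
qed


section \<open>Gcd-closed submodules\<close>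

lemma is_gcd_divides: "is_gcd g a b \<Longrightarrow> g \<noteq> 0 \<and> a / g \<in> R \<and> b / g \<in> R"
  unfolding is_gcd_def by blast

lemma is_gcd_test: "is_gcd g a b \<Longrightarrow> y * a \<in> R \<Longrightarrow> y * b \<in> R \<Longrightarrow> y * g \<in> R"
  unfolding is_gcd_def by blast

lemma is_gcd_scale:
  assumes "c \<noteq> 0" "is_gcd g a b"
  shows "is_gcd (c * g) (c * a) (c * b)"
  using assms unfolding is_gcd_def by (auto simp flip: mult.assoc)

lemma is_gcd_cofactors: "is_gcd g a b \<Longrightarrow> is_gcd 1 (a / g) (b / g)"
  using is_gcd_scale[of "1 / g" g a b] is_gcd_divides[of g a b] by simp

lemma is_gcd_mem: "is_gcd g a b \<Longrightarrow> a \<in> R \<Longrightarrow> b \<in> R \<Longrightarrow> g \<in> R"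
  by (metis is_gcd_test mult_1)

lemma is_gcd_commute: "is_gcd g a b \<Longrightarrow> is_gcd g b a"
  unfolding is_gcd_def by blast

lemma coprime_mem: "is_gcd 1 a b \<Longrightarrow> a \<in> R \<and> b \<in> R"
  by (metis div_by_1 is_gcd_divides)

lemma coprime_mult:
  assumes "is_gcd 1 a b" "is_gcd 1 a c"
  shows "is_gcd 1 a (b * c)"
proof -
  have "y \<in> R" if y: "y * a \<in> R" "y * (b * c) \<in> R" for y
  proof -
    have "y * b * a \<in> R" using coprime_mem[OF assms(1)] y(1) mult_mem[of "y * a" b]
      by (simp add: mult_ac)
    moreover have "y * b * c \<in> R" using y(2) by (simp add: mult.assoc)
    ultimately have "y * b \<in> R" using is_gcd_test[OF assms(2), of "y * b"] by simp
    then show ?thesis using is_gcd_test[OF assms(1) y(1)] by simp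
  qed
  moreover have "a \<in> R" "b * c \<in> R" using assms[THEN coprime_mem] by (auto simp: mult_mem)
  ultimately show ?thesis
    unfolding is_gcd_def div_by_1 mult_1_right using one_neq_zero by blast
qed

definition gcd_closed :: "'k set \<Rightarrow> bool" where
  "gcd_closed I \<longleftrightarrow> (\<forall>a\<in>I. \<forall>b\<in>I. \<forall>g. is_gcd g a b \<longrightarrow> g \<in> I)"

text \<open>
  For a \<open>t\<close>-ideal \<open>I\<close> of a GCD domain this is the inclusion \<open>I \<subseteq> (I\<^sup>2)\<^sub>t\<close> (see
  \<open>mem_t_mult_self\<close>), hence \<open>t\<close>-idempotence if \<open>I \<subseteq> R\<close>. This elementwise form is evidently
  preserved by unions of chains.
\<close>

definition square_divisible :: "'k set \<Rightarrow> bool" where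
  "square_divisible I \<longleftrightarrow> (\<forall>x\<in>I. \<exists>d\<in>I. \<exists>r\<in>R. x = r * d\<^sup>2)"

lemma gcd_closed_if_t_ideal:
  assumes "t_ideal R I"
  shows "gcd_closed I"
  unfolding gcd_closed_def
proof (intro ballI allI impI)
  fix a b g assume ab: "a \<in> I" "b \<in> I" and g: "is_gcd g a b"
  let ?A = "is_submodule R hull {a, b}"
  have mem: "a \<in> ?A" "b \<in> ?A" by (auto intro: hull_inc)
  have sub: "is_submodule R I" using assms by (simp add: t_ideal_def fractional_ideal_def)
  show "g \<in> I"
  proof (cases "a = 0 \<and> b = 0")
    case True
    \<comment> \<open>Here the gcd condition only allows \<open>R = K\<close>, in which case \<open>I = K\<close> too.\<close>
    obtain z where z: "z \<in> I" "z \<noteq> 0"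
      using assms submodule_nonzero_element[OF sub] by (auto simp: t_ideal_def)
    have "1 / z * g \<in> R" using is_gcd_test[OF g, of "1 / z"] True by (simp add: zero_mem)
    then have "g / z \<in> R" by simp
    then have "g / z * z \<in> I" using z(1) sub unfolding is_submodule_def by blast
    then show ?thesis using z by simp
  next
    case False
    then have "?A \<noteq> {0}" using mem by auto
    moreover have "?A \<subseteq> I" using ab sub by (simp add: hull_subset_iff)
    moreover have "fin_gen R ?A" by (simp add: fin_gen_hull)
    ultimately have "v_closure R ?A \<subseteq> t_closure R I" unfolding t_closure_def by blast
    moreover have "g \<in> v_closure R ?A"
      unfolding mem_v_closure_iff using is_gcd_test[OF g] mem by (metis mult.commute)
    ultimately show ?thesis using assms by (auto simp: t_ideal_def)
  qed
qed

end


section \<open>GCD domains\<close>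

locale gcd_domain = domain_with_quotient_field +
  assumes gcd_exists: "a \<noteq> 0 \<Longrightarrow> \<exists>g. is_gcd g a b"
begin

lemma common_divisor:
  assumes "gcd_closed I" "a \<in> I" "b \<in> I"
  shows "\<exists>d\<in>I. a \<in> scaled d R \<and> b \<in> scaled d R"
proof (cases "a = 0")
  case True
  then show ?thesis
    using assms zero_mem one_mem by (intro bexI[of _ b]) (auto simp: scaled_def)
next
  case False
  then obtain g where g: "is_gcd g a b" using gcd_exists by blast
  then have "g \<in> I" using assms unfolding gcd_closed_def by blast
  then show ?thesis
    using is_gcd_divides[OF g] by (intro bexI[of _ g]) (auto simp: mem_scaled_iff)
qed

text \<open>
  A submodule that is directed under divisibility is a directed union of principal submodules, and
  these are divisorial.
\<close>

lemma t_closure_subset_if_directed: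
  assumes "0 \<in> I" "\<And>d. d \<in> I \<Longrightarrow> scaled d R \<subseteq> I"
    and directed: "\<And>a b. a \<in> I \<Longrightarrow> b \<in> I \<Longrightarrow> \<exists>d\<in>I. a \<in> scaled d R \<and> b \<in> scaled d R"
  shows "t_closure R I \<subseteq> I"
proof
  fix x assume "x \<in> t_closure R I"
  then obtain F where F: "finite F" "is_submodule R hull F \<noteq> {0}" "is_submodule R hull F \<subseteq> I"
    and x: "x \<in> v_closure R (is_submodule R hull F)"
    by (auto simp: t_closure_def fin_gen_def)
  have "F \<subseteq> I" using F(3) hull_subset[of F "is_submodule R"] by blast
  with F(1) have "\<exists>d\<in>I. F \<subseteq> scaled d R"
  proof (induction F)
    case (insert a F)
    then obtain e where e: "e \<in> I" "F \<subseteq> scaled e R" by auto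
    then obtain d where d: "d \<in> I" "a \<in> scaled d R" "e \<in> scaled d R"
      using directed[of a e] insert.prems by auto
    then have "scaled e R \<subseteq> scaled d R"
      by (auto simp: scaled_def image_iff mult.assoc) (metis mult_mem)
    then show ?case using d e by blast
  qed (use assms(1) in blast)
  then obtain d where d: "d \<in> I" "F \<subseteq> scaled d R" by blast
  then have A: "is_submodule R hull F \<subseteq> scaled d R"
    by (simp add: hull_subset_iff is_submodule_scaled is_submodule_self)
  have "d \<noteq> 0"
  proof
    assume "d = 0"
    then have "is_submodule R hull F \<subseteq> {0}" using A by (auto simp: scaled_def)
    then show False using F(2) is_submodule_hull[of R F] by (auto simp: is_submodule_def)
  qed
  then have "\<forall>a\<in>is_submodule R hull F. 1 / d * a \<in> R" using A by (auto simp: mem_scaled_iff)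
  then have "x * (1 / d) \<in> R" using x unfolding mem_v_closure_iff by blast
  then have "x \<in> scaled d R" using \<open>d \<noteq> 0\<close> by (simp add: mem_scaled_iff)
  then show "x \<in> I" using assms(2) d(1) by blast
qed

lemma t_ideal_if_gcd_closed:
  assumes "is_ideal R I" "I \<noteq> {0}" "gcd_closed I"
  shows "t_ideal R I"
proof -
  have sub: "is_submodule R I" "I \<subseteq> R" using assms by (auto simp: is_ideal_def)
  have "t_closure R I \<subseteq> I"
  proof (rule t_closure_subset_if_directed)
    show "0 \<in> I" using sub by (simp add: is_submodule_def)
    show "scaled d R \<subseteq> I" if "d \<in> I" for d
      using that sub(1) by (auto simp: is_submodule_def scaled_def mult.commute[of d])
  qed (rule common_divisor[OF assms(3)])
  then have "t_closure R I = I" using subset_t_closure[OF sub(1) assms(2)] by blast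
  then show ?thesis
    using assms sub one_mem by (auto simp: t_ideal_def fractional_ideal_def intro!: bexI[of _ 1])
qed

text \<open>
  Finitely many elements of \<open>J\<close> have a gcd \<open>d\<close> in \<open>J\<close>, and then all their products lie in
  \<open>d\<^sup>2R\<close>.
\<close>

lemma mem_t_mult_self:
  assumes "t_ideal R J" "x \<in> t_mult R J J"
  shows "\<exists>d\<in>J. \<exists>r\<in>R. x = r * d\<^sup>2"
proof -
  define D where "D = {r * d\<^sup>2 |r d. r \<in> R \<and> d \<in> J}"
  have J0: "0 \<in> J" using assms by (auto simp: t_ideal_def fractional_ideal_def is_submodule_def)
  have div: "\<exists>d\<in>J. \<exists>u\<in>R. \<exists>v\<in>R. a = u * d \<and> b = v * d" if "a \<in> J" "b \<in> J" for a b
    using common_divisor[OF gcd_closed_if_t_ideal[OF assms(1)] that]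
    by (auto simp: scaled_def mult.commute)
  have pair: "\<exists>d\<in>J. \<exists>r\<in>R. \<exists>s\<in>R. a = r * d\<^sup>2 \<and> b = s * d\<^sup>2" if ab: "a \<in> D" "b \<in> D" for a b
  proof -
    obtain r1 d1 r2 d2 where 1: "a = r1 * d1\<^sup>2" "r1 \<in> R" "d1 \<in> J"
      and 2: "b = r2 * d2\<^sup>2" "r2 \<in> R" "d2 \<in> J"
      using ab by (auto simp: D_def)
    obtain d u v where "d \<in> J" "u \<in> R" "v \<in> R" "d1 = u * d" "d2 = v * d"
      using div[OF 1(3) 2(3)] by blast
    with 1 2 show ?thesis
      by (intro bexI[of _ d] bexI[of _ "r1 * u\<^sup>2"] bexI[of _ "r2 * v\<^sup>2"])
        (auto simp: power2_eq_square mult_mem mult_ac)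
  qed
  have subD: "is_submodule R D"
    unfolding is_submodule_def
  proof (intro conjI ballI)
    show "0 \<in> D" using J0 zero_mem by (auto simp: D_def)
    show "a + b \<in> D" if ab: "a \<in> D" "b \<in> D" for a b
    proof -
      obtain d r s where "d \<in> J" "r \<in> R" "s \<in> R" "a = r * d\<^sup>2" "b = s * d\<^sup>2"
        using pair[OF ab] by blast
      then have "a + b = (r + s) * d\<^sup>2" "r + s \<in> R" "d \<in> J"
        by (auto simp: distrib_right add_mem)
      then show ?thesis unfolding D_def by blast
    qed
    show "r * a \<in> D" if "r \<in> R" "a \<in> D" for r a
      using that mult_mem unfolding D_def by clarsimp (metis mult.assoc)
  qed
  have "module_prod R J J \<subseteq> D"
  proof (rule module_prod_least[OF subD])
    fix a b assume "a \<in> J" "b \<in> J"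
    then obtain d u v where "d \<in> J" "u \<in> R" "v \<in> R" "a = u * d" "b = v * d" using div by blast
    then have "a * b = (u * v) * d\<^sup>2" "u * v \<in> R" "d \<in> J"
      by (auto simp: power2_eq_square mult_mem mult_ac)
    then show "a * b \<in> D" unfolding D_def by blast
  qed
  moreover have "t_closure R D \<subseteq> D"
  proof (rule t_closure_subset_if_directed)
    show "0 \<in> D" using subD by (simp add: is_submodule_def)
    show "scaled d R \<subseteq> D" if "d \<in> D" for d
      using that subD by (auto simp: is_submodule_def scaled_def mult.commute[of d])
    fix a b assume "a \<in> D" "b \<in> D"
    then obtain d r s where *: "d \<in> J" "r \<in> R" "s \<in> R" "a = r * d\<^sup>2" "b = s * d\<^sup>2"
      using pair by blast
    moreover have "1 * d\<^sup>2 \<in> D" using * one_mem unfolding D_def by blast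
    ultimately show "\<exists>d\<in>D. a \<in> scaled d R \<and> b \<in> scaled d R"
      by (intro bexI[of _ "d\<^sup>2"]) (auto simp: scaled_def)
  qed
  ultimately have "x \<in> D"
    using assms(2) t_closure_mono[of "module_prod R J J" D R] by (auto simp: t_mult_def)
  then show ?thesis by (auto simp: D_def)
qed


section \<open>Idempotent ideals\<close>

text \<open>
  Write \<open>x = rd\<^sup>2\<close> with \<open>d = a/b\<close> in lowest terms: as \<open>x\<close> is in \<open>R\<close>, the denominator \<open>b\<^sup>2\<close>
  divides \<open>r\<close>, so \<open>x\<close> is a multiple of \<open>a\<^sup>2\<close>, and \<open>a = bd\<close> is an element of the ideal.
\<close>

lemma square_divisible_Int_ring:
  assumes "is_submodule R J" "square_divisible J"
  shows "square_divisible (J \<inter> R)"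
  unfolding square_divisible_def
proof
  fix x assume x: "x \<in> J \<inter> R"
  then obtain d r where d: "d \<in> J" "r \<in> R" "x = r * d\<^sup>2"
    using assms(2) by (auto simp: square_divisible_def)
  obtain g where g: "is_gcd g 1 d" using gcd_exists[of 1 d] by auto
  define a b where "a = d / g" and "b = 1 / g"
  have g0: "g \<noteq> 0" using is_gcd_divides[OF g] by blast
  have ba: "is_gcd 1 b a" unfolding a_def b_def using g by (rule is_gcd_cofactors)
  then have ab: "a \<in> R" "b \<in> R" using coprime_mem by blast+
  have "is_gcd 1 b (a\<^sup>2)" unfolding power2_eq_square using ba by (intro coprime_mult)
  then have "is_gcd 1 (a\<^sup>2) (b\<^sup>2)"
    unfolding power2_eq_square[of b] by (intro coprime_mult) (auto intro: is_gcd_commute)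
  moreover have eq: "x = r * g\<^sup>2 * a\<^sup>2" using g0 d by (simp add: a_def power_divide)
  moreover have "r * g\<^sup>2 * b\<^sup>2 \<in> R" using g0 d by (simp add: b_def power_divide)
  ultimately have "r * g\<^sup>2 \<in> R"
    using x is_gcd_test[of 1 "a\<^sup>2" "b\<^sup>2" "r * g\<^sup>2"] by (metis IntD2 mult_1_right)
  moreover have "b * d \<in> J" using assms(1) ab d by (auto simp: is_submodule_def)
  then have "a \<in> J \<inter> R" using ab by (simp add: a_def b_def)
  ultimately show "\<exists>d\<in>J \<inter> R. \<exists>r\<in>R. x = r * d\<^sup>2" using eq by blast
qed

text \<open>
  Let \<open>xb = rd\<^sup>2\<close> and divide \<open>d\<close> and \<open>b\<close> by their gcd, with coprime cofactors \<open>d'\<close> and \<open>b'\<close>.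
  If \<open>g\<close> is the gcd, then \<open>xb' = rgd'\<^sup>2\<close>, and as \<open>d'\<^sup>2\<close> is coprime to \<open>b'\<close>, it divides \<open>x\<close>.
  Moreover \<open>d'b = db'\<close> shows that \<open>d'\<close> is in the colon ideal.
\<close>

lemma square_divisible_colon:
  assumes "is_ideal R I" "square_divisible I" "b \<in> R" "b \<noteq> 0"
  shows "square_divisible {x \<in> R. x * b \<in> I}"
  unfolding square_divisible_def
proof
  fix x assume "x \<in> {x \<in> R. x * b \<in> I}"
  then have x: "x \<in> R" "x * b \<in> I" by auto
  then obtain d r where d: "d \<in> I" "r \<in> R" "x * b = r * d\<^sup>2"
    using assms(2) by (auto simp: square_divisible_def)
  show "\<exists>d\<in>{x \<in> R. x * b \<in> I}. \<exists>r\<in>R. x = r * d\<^sup>2"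
  proof (cases "d = 0")
    case True
    then have "x = 0" using d assms by simp
    then show ?thesis using x zero_mem by auto
  next
    case False
    obtain g where g: "is_gcd g b d" using gcd_exists assms by blast
    define b' d' where "b' = b / g" and "d' = d / g"
    have g0: "g \<noteq> 0" using is_gcd_divides[OF g] by blast
    have d0: "d' \<noteq> 0" using False g0 by (simp add: d'_def)
    have dR: "d \<in> R" using d assms by (auto simp: is_ideal_def)
    have gR: "g \<in> R" by (rule is_gcd_mem[OF g assms(3) dR])
    have cop: "is_gcd 1 b' d'" unfolding b'_def d'_def using g by (rule is_gcd_cofactors)
    then have R': "b' \<in> R" "d' \<in> R" using coprime_mem by blast+
    define w where "w = x / d'\<^sup>2"
    have "is_gcd 1 b' (d'\<^sup>2)"
      unfolding power2_eq_square using cop by (intro coprime_mult)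
    moreover have "w * d'\<^sup>2 = x" using d0 by (simp add: w_def)
    moreover have "w * b' = r * g"
      using d(3) g0 False by (simp add: w_def b'_def d'_def field_simps power2_eq_square)
    ultimately have "w \<in> R"
      using x(1) d(2) gR is_gcd_test[of 1 b' "d'\<^sup>2" w] by (simp add: mult_mem)
    moreover have "b' * d \<in> I" using R' d assms by (auto simp: is_ideal_def is_submodule_def)
    then have "d' * b \<in> I" using g0 by (simp add: b'_def d'_def mult.commute)
    ultimately show ?thesis using R' \<open>w * d'\<^sup>2 = x\<close> by auto
  qed
qed

lemma gcd_closed_colon:
  assumes "gcd_closed I" "b \<noteq> 0"
  shows "gcd_closed {x \<in> R. x * b \<in> I}"
  unfolding gcd_closed_def
proof (intro ballI allI impI)
  fix x y g assume xy: "x \<in> {x \<in> R. x * b \<in> I}" "y \<in> {x \<in> R. x * b \<in> I}" and g: "is_gcd g x y"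
  have "is_gcd (b * g) (b * x) (b * y)" using g assms by (intro is_gcd_scale)
  moreover have "b * x \<in> I" "b * y \<in> I" using xy by (auto simp: mult.commute)
  ultimately have "b * g \<in> I" using assms unfolding gcd_closed_def by blast
  then have "g * b \<in> I" by (simp add: mult.commute)
  moreover have "g \<in> R" using is_gcd_mem[OF g] xy by simp
  ultimately show "g \<in> {x \<in> R. x * b \<in> I}" by simp
qed

text \<open>
  A maximal element \<open>P\<close> among the proper idempotent gcd-closed ideals above \<open>I\<close> is prime: if
  \<open>ab \<in> P\<close> and \<open>b \<notin> P\<close>, then \<open>(P : b)\<close> belongs to the same family, so it equals \<open>P\<close>, and it
  contains \<open>a\<close>.
\<close>

lemma prime_idempotent_above:
  assumes "is_ideal R I" "gcd_closed I" "square_divisible I" "1 \<notin> I"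
  obtains P where "I \<subseteq> P" "prime_ideal R P" "gcd_closed P" "square_divisible P"
proof -
  define \<F> where "\<F> = {P. is_ideal R P \<and> gcd_closed P \<and> square_divisible P \<and> 1 \<notin> P \<and> I \<subseteq> P}"
  have "\<exists>P\<in>\<F>. \<forall>X\<in>\<F>. P \<subseteq> X \<longrightarrow> X = P"
  proof (rule subset_Zorn_nonempty)
    show "\<F> \<noteq> {}" using assms by (auto simp: \<F>_def)
    fix \<C> assume ne: "\<C> \<noteq> {}" and chain: "subset.chain \<F> \<C>"
    have mem: "is_ideal R C" "gcd_closed C" "square_divisible C" "1 \<notin> C" "I \<subseteq> C" if "C \<in> \<C>" for C
      using that chain by (auto simp: \<F>_def subset.chain_def)
    have pair: "\<exists>C\<in>\<C>. a \<in> C \<and> b \<in> C" if "a \<in> \<Union>\<C>" "b \<in> \<Union>\<C>" for a b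
      using that chain unfolding subset_chain_def by blast
    have "is_ideal R (\<Union>\<C>)"
      unfolding is_ideal_def is_submodule_def
    proof (intro conjI ballI)
      show "0 \<in> \<Union>\<C>" using ne mem(1) by (auto simp: is_ideal_def is_submodule_def)
      show "a + b \<in> \<Union>\<C>" if "a \<in> \<Union>\<C>" "b \<in> \<Union>\<C>" for a b
        using pair[OF that] mem(1) unfolding is_ideal_def is_submodule_def by blast
      show "r * a \<in> \<Union>\<C>" if "r \<in> R" "a \<in> \<Union>\<C>" for r a
        using that mem(1) unfolding is_ideal_def is_submodule_def by blast
      show "\<Union>\<C> \<subseteq> R" using mem(1) unfolding is_ideal_def by blast
    qed
    moreover have "gcd_closed (\<Union>\<C>)"
      unfolding gcd_closed_def using pair mem(2) unfolding gcd_closed_def by blast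
    moreover have "square_divisible (\<Union>\<C>)"
      using mem(3) unfolding square_divisible_def by blast
    moreover have "1 \<notin> \<Union>\<C>" "I \<subseteq> \<Union>\<C>" using mem(4,5) ne by blast+
    ultimately show "\<Union>\<C> \<in> \<F>" by (simp add: \<F>_def)
  qed
  then obtain P where P: "P \<in> \<F>" and max: "\<And>X. X \<in> \<F> \<Longrightarrow> P \<subseteq> X \<Longrightarrow> X = P" by blast
  have ideal: "is_ideal R P" "gcd_closed P" "square_divisible P" "1 \<notin> P" "I \<subseteq> P"
    using P by (auto simp: \<F>_def)
  have "a \<in> P \<or> b \<in> P" if ab: "a \<in> R" "b \<in> R" "a * b \<in> P" for a b
  proof (rule ccontr)
    assume n: "\<not> (a \<in> P \<or> b \<in> P)"
    define Q where "Q = {x \<in> R. x * b \<in> P}"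
    have "b \<noteq> 0" using n ideal by (auto simp: is_ideal_def is_submodule_def)
    have "is_ideal R Q"
      unfolding Q_def using ideal(1) ab
      by (auto simp: is_ideal_def is_submodule_def zero_mem add_mem mult_mem distrib_right mult.assoc)
    moreover have "gcd_closed Q"
      unfolding Q_def using ideal \<open>b \<noteq> 0\<close> by (intro gcd_closed_colon)
    moreover have "square_divisible Q"
      unfolding Q_def using ideal ab \<open>b \<noteq> 0\<close> by (intro square_divisible_colon)
    moreover have "1 \<notin> Q" using n by (simp add: Q_def)
    moreover have "P \<subseteq> Q"
      using ideal(1) ab by (auto simp: Q_def is_ideal_def is_submodule_def mult.commute)
    ultimately have "Q = P" using ideal(5) by (intro max) (auto simp: \<F>_def)
    then show False using n ab by (auto simp: Q_def)
  qed
  then have "prime_ideal R P" using ideal one_mem by (auto simp: prime_ideal_def)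
  then show thesis using that ideal by blast
qed

text \<open>
  This is where strong \<open>t\<close>-discreteness enters. Cutting \<open>J\<close> down to \<open>R\<close> turns a fractional
  \<open>t\<close>-ideal into an ideal without losing idempotence or creating \<open>1\<close>, so it would lie in a
  \<open>t\<close>-idempotent \<open>t\<close>-prime.
\<close>

lemma one_mem_if_t_idempotent:
  assumes "strongly_t_discrete R" "t_ideal R J" "t_mult R J J = J"
  shows "1 \<in> J"
proof (rule ccontr)
  assume "1 \<notin> J"
  have sub: "is_submodule R J" using assms(2) by (simp add: t_ideal_def fractional_ideal_def)
  have "square_divisible J"
    using mem_t_mult_self[OF assms(2)] assms(3) by (auto simp: square_divisible_def)
  then have sd: "square_divisible (J \<inter> R)" using sub by (intro square_divisible_Int_ring)
  have ideal: "is_ideal R (J \<inter> R)"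
    using sub is_submodule_self by (auto simp: is_ideal_def is_submodule_def)
  have gc: "gcd_closed (J \<inter> R)"
    using gcd_closed_if_t_ideal[OF assms(2)] is_gcd_mem unfolding gcd_closed_def by blast
  obtain P where P: "J \<inter> R \<subseteq> P" "prime_ideal R P" "gcd_closed P" "square_divisible P"
    using prime_idempotent_above[OF ideal gc sd] \<open>1 \<notin> J\<close> by auto
  obtain z where z: "z \<in> J" "z \<noteq> 0"
    using assms(2) submodule_nonzero_element[OF sub] by (auto simp: t_ideal_def)
  obtain d where d: "d \<in> R" "d \<noteq> 0" "d * z \<in> R" using common_denominator by blast
  have "d * z \<in> P" using z d sub P(1) by (auto simp: is_submodule_def)
  then have "P \<noteq> {0}" using z d by auto
  then have tP: "t_ideal R P"
    using P by (intro t_ideal_if_gcd_closed) (auto simp: prime_ideal_def)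
  have subM: "is_submodule R (module_prod R P P)"
    by (simp add: module_prod_def is_submodule_hull)
  have "P \<subseteq> module_prod R P P"
  proof
    fix x assume "x \<in> P"
    then obtain e r where e: "e \<in> P" "r \<in> R" "x = r * e\<^sup>2"
      using P(4) by (auto simp: square_divisible_def)
    then have "e * e \<in> module_prod R P P" by (intro mult_mem_module_prod)
    then show "x \<in> module_prod R P P"
      using e subM by (simp add: is_submodule_def power2_eq_square)
  qed
  then have "P \<subseteq> t_mult R P P"
    using tP t_closure_mono[of P "module_prod R P P" R] by (simp add: t_mult_def t_ideal_def)
  then show False
    using assms(1) P(2) tP by (auto simp: strongly_t_discrete_def t_prime_ideal_def)
qed

text \<open>
  The required generator of \<open>I\<close> is the factor \<open>c\<close> with \<open>(I\<^sup>2)\<^sub>t = cI\<close>: the \<open>t\<close>-idempotent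
  \<open>c\<^sup>-\<^sup>1I\<close> contains \<open>1\<close>, so it coincides with its endomorphism ring.
\<close>

lemma stable_if_Boole_discrete:
  assumes "Boole_t_regular R" "strongly_t_discrete R"
  shows "strongly_t_stable R"
  unfolding strongly_t_stable_def
proof (intro allI impI)
  fix I assume I: "t_ideal R I"
  obtain c where c: "c \<noteq> 0" "t_mult R I I = scaled c I"
    using assms(1) I by (auto simp: Boole_t_regular_iff)
  define J where "J = scaled (1 / c) I"
  have J: "t_ideal R J" unfolding J_def using c I by (intro t_ideal_scaled) auto
  have idem: "t_mult R J J = J"
    using c by (simp add: J_def t_mult_scaled scaled_scaled)
  have one: "1 \<in> J" using assms(2) J idem by (rule one_mem_if_t_idempotent)
  have "colon J J \<subseteq> J" using one by (auto simp: colon_def dest: bspec[of J _ 1])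
  moreover have "J \<subseteq> colon J J"
  proof
    fix x assume "x \<in> J"
    have "1 * 1 \<in> module_prod R J J" using one by (intro mult_mem_module_prod)
    then have "module_prod R J J \<noteq> {0}" by (metis mult_1 singletonD zero_neq_one)
    then have "module_prod R J J \<subseteq> J"
      using subset_t_closure[of R "module_prod R J J"] idem
      by (simp add: t_mult_def module_prod_def is_submodule_hull)
    then show "x \<in> colon J J"
      using \<open>x \<in> J\<close> mult_mem_module_prod[of x J _ J R] by (auto simp: colon_def)
  qed
  ultimately have "J = colon I I" using c by (simp add: J_def colon_scaled)
  moreover have "I = scaled c J" using c by (simp add: J_def scaled_scaled)
  moreover have "c \<in> I" using one c by (simp add: J_def mem_scaled_iff)
  ultimately show "\<exists>c\<in>I. I = scaled c (colon I I)" by auto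
qed

end


section \<open>The characterization\<close>

theorem theorem2p6:
  fixes R :: "'k::field set"
  assumes "domain_with_quotient_field R"
    and "v_domain R"
  shows "Boole_t_regular R \<and> strongly_t_discrete R \<longleftrightarrow> strongly_t_stable R"
proof
  interpret domain_with_quotient_field R by fact
  show "Boole_t_regular R \<and> strongly_t_discrete R" if "strongly_t_stable R"
    using that Boole_if_stable discrete_if_stable by blast
  show "strongly_t_stable R" if "Boole_t_regular R \<and> strongly_t_discrete R"
  proof -
    interpret gcd_domain R
      using assms(2) that by unfold_locales (blast intro: gcd_exists_if_Boole)
    show ?thesis using that stable_if_Boole_discrete by blast
  qed
qed

end
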